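(* Let $d\in\mathbb C$, let $Z=\mathrm{diag}(z_1,\ldots,z_m)$ and let $T=(t_{i,j})$ be an $m\times m$ matrix such that $\|ZT\|<1$. If there exist a symmetric matrix $\Sigma\in\mathbb C^{p\times p}$ and $H_1,\ldots,H_m\in\mathbb C^{p\times p}$ such that $ZT=\Sigma(H_1z_1+\cdots+H_mz_m)$, then $$\mathrm{per}_d[T(\boldsymbol i)]=E[(d\,.\,\beta\,.\,\tilde{\boldsymbol\rho})^{\boldsymbol i}],$$ where $\boldsymbol i=(i_1,\ldots,i_m)$ is a multi-index of nonnegative integers, $\tilde{\boldsymbol\rho}=(\bar u_1\rho_1,\ldots,\bar u_m\rho_m)$ and $\boldsymbol\rho=(\rho_1,\ldots,\rho_m)$ is such that $$E[\boldsymbol\rho^{\boldsymbol i}]=\sum_{\mathfrak a\in\boldsymbol M_m[\boldsymbol i]}\mathrm{Tr}\Big[\prod_{k\in\mathfrak a}(\Sigma H_k)\Big]+\sum_{\mathfrak a\in\boldsymbol N_m[\boldsymbol i]-\boldsymbol M_m[\boldsymbol i]}\frac1{d_{\mathfrak a}}\mathrm{Tr}\Big[\prod_{k\in\mathfrak a}(\Sigma H_k)\Big],$$ with $d_{\mathfrak a}$ the period of the necklace $[\mathfrak a]$.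
   Context: **Permanents.** For a square matrix $Y=(y_{ij})\in\mathbb C^{q\times q}$ and $d\in\mathbb C$, the $d$-permanent is $\mathrm{per}_d(Y)=\sum_{\sigma\in\mathfrak S_q}d^{|C(\sigma)|}\prod_{j=1}^qy_{j,\sigma(j)}$, with $\mathfrak S_q$ the symmetric group and $|C(\sigma)|$ the number of cycles of $\sigma$. For an $m\times m$ matrix $A$ with eigenvalues $\theta_1,\ldots,\theta_m$, $\|A\|=\max\{|\theta_1|,\ldots,|\theta_m|\}$. For $\boldsymbol i=(i_1,\ldots,i_m)$, $T(\boldsymbol i)$ is the matrix $$T(\boldsymbol i)=\begin{pmatrix}t_{i_1,i_1}&\cdots&t_{i_1,i_m}\\ \vdots&&\vdots\\ t_{i_m,i_1}&\cdots&t_{i_m,i_m}\end{pmatrix}$$ appearing in the $d$-extension of the master theorem, which the paper recalls in the form: if $\|ZT\|<1$ then $\mathrm{per}_d[T(\boldsymbol i)]=\frac{\partial^{|\boldsymbol i|}}{\partial z_1^{i_1}\cdots\partial z_m^{i_m}}\left[\det(I-ZT)^{-d}\right]_{\boldsymbol z=\boldsymbol 0}$. **Necklaces.** $|\boldsymbol i|=i_1+\cdots+i_m$ and $\boldsymbol i!=i_1!\cdots i_m!$. An $m$-ary necklace of length $|\boldsymbol i|$ is an equivalence class, under rotation, of strings in $\{1,\ldots,m\}^{|\boldsymbol i|}$; its representative $\mathfrak a$ is its lexicographically smallest string, and the necklace is denoted $[\mathfrak a]$. In most cases a necklace has full size, equal to the length of a string (it is then aperiodic); but there are periodic necklaces,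 whose period, the number of distinct strings in the class, is a proper divisor of the length (for example, $111$ has period $1$). A necklace is of kind $\boldsymbol i$ if the elements of its strings are chosen in the multiset $\{1^{i_1},\ldots,m^{i_m}\}$, i.e. the letter $j$ occurs $i_j$ times. $\boldsymbol N_m[\boldsymbol i]$ is the set of representatives of necklaces of kind $\boldsymbol i$, and $\boldsymbol M_m[\boldsymbol i]$ the set of representatives of the aperiodic ones. Products over $k\in\mathfrak a$ are taken in the order of the letters of the string. **Multivariate umbral calculus.** $E$ is a linear evaluation functional on polynomials in umbrae (symbols), with $E[1]=1$ and factorizing over distinct umbrae. An $m$-tuple $\boldsymbol\nu=(\nu_1,\ldots,\nu_m)$ of umbral monomials has multivariate moments $E[\boldsymbol\nu^{\boldsymbol i}]=E[\nu_1^{i_1}\cdots\nu_m^{i_m}]$, equal to $1$ at $\boldsymbol i=\boldsymbol0$ (so the formula for $E[\boldsymbol\rho^{\boldsymbol i}]$ is for nonzero $\boldsymbol i$), and g.f. $f(\boldsymbol\nu,\boldsymbol z)=\sum_{\boldsymbol i}E[\boldsymbol\nu^{\boldsymbol i}]\boldsymbol z^{\boldsymbol i}/\boldsymbol i!$. For a scalar $d$ and the Bell umbra $\beta$ (g.f. $\exp(e^z-1)$), the auxiliary tuple $d\,.\,\beta\,.\,\boldsymbol\nu$ has g.f. $\exp\{d[f(\boldsymbol\nu,\boldsymbol z)-1]\}$. $\bar u_1,\ldots,\bar u_m$ are uncorrelated umbrae with $E[\bar u_j^i]=i!$, uncorrelated with $\boldsymbol\rho$.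
   Formalization: d_a is taken as the length divided by the period (number of repetitions of the primitive block), since with the period the claim fails (m=1, d=1, i=2); ZT=Σ(H_1z_1+…+H_mz_m) is required for every z with ‖ZT‖<1; T(i) is the matrix of order |i| repeating t_{jk} in i_j×i_k blocks. *)

theory Defs
  imports
    "HOL-Combinatorics.Orbits"
    "HOL-Library.Poly_Mapping"
    "Jordan_Normal_Form.Spectral_Radius"
begin

text \<open>
  Indices and letters run over \<open>0, \<dots>, m - 1\<close> instead of \<open>1, \<dots>, m\<close>.
  An \<open>m\<close>-ary multi-index is a function that vanishes from \<open>m\<close> on.
\<close>

definition multi_indices :: "nat \<Rightarrow> (nat \<Rightarrow> nat) set" where
  "multi_indices m = {i. \<forall>j\<ge>m. i j = 0}"

section \<open>The \<open>d\<close>-permanent\<close>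

text \<open>Fixed points count as cycles: \<open>orbit \<sigma> x = {x}\<close> if \<open>\<sigma> x = x\<close>.\<close>

definition cycle_count :: "nat \<Rightarrow> (nat \<Rightarrow> nat) \<Rightarrow> nat" where
  "cycle_count q \<sigma> = card (orbit \<sigma> ` {..<q})"

definition d_permanent :: "complex \<Rightarrow> complex mat \<Rightarrow> complex" where
  "d_permanent d Y =
    (\<Sum>\<sigma> | \<sigma> permutes {..<dim_row Y}.
       d ^ cycle_count (dim_row Y) \<sigma> * (\<Prod>j<dim_row Y. Y $$ (j, \<sigma> j)))"

text \<open>
  \<open>T(\<^bold>i)\<close> is the matrix with entries \<open>t\<^bsub>w\<^sub>r,w\<^sub>s\<^esub>\<close>, where \<open>w\<close> lists the multiset
  \<open>{1\<^bsup>i\<^sub>1\<^esup>, \<dots>, m\<^bsup>i\<^sub>m\<^esup>}\<close> in increasing order. It has order \<open>i\<^sub>1 + \<dots> + i\<^sub>m\<close>,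
  as in the \<open>d\<close>-extension of MacMahon's master theorem.
\<close>

definition index_word :: "nat \<Rightarrow> (nat \<Rightarrow> nat) \<Rightarrow> nat list" where
  "index_word m i = concat (map (\<lambda>j. replicate (i j) j) [0..<m])"

definition repeated_mat :: "nat \<Rightarrow> complex mat \<Rightarrow> (nat \<Rightarrow> nat) \<Rightarrow> complex mat" where
  "repeated_mat m T i =
    (let w = index_word m i in mat (length w) (length w) (\<lambda>(r, s). T $$ (w ! r, w ! s)))"

section \<open>Matrices\<close>

definition mat_trace :: "complex mat \<Rightarrow> complex" where
  "mat_trace A = (\<Sum>r<dim_row A. A $$ (r, r))"

definition mat_lincomb :: "nat \<Rightarrow> nat \<Rightarrow> (nat \<Rightarrow> complex mat) \<Rightarrow> (nat \<Rightarrow> complex) \<Rightarrow> complex mat" where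
  "mat_lincomb p m H z = mat p p (\<lambda>(r, s). \<Sum>k<m. z k * H k $$ (r, s))"

definition string_mat_prod :: "nat \<Rightarrow> (nat \<Rightarrow> complex mat) \<Rightarrow> nat list \<Rightarrow> complex mat" where
  "string_mat_prod p A a = foldr (\<lambda>k M. A k * M) a (1\<^sub>m p)"

section \<open>Necklaces\<close>

definition necklace :: "nat list \<Rightarrow> nat list set" where
  "necklace a = range (\<lambda>r. rotate r a)"

definition necklace_period :: "nat list \<Rightarrow> nat" where
  "necklace_period a = card (necklace a)"

text \<open>
  The number of times the primitive block is repeated: the length divided by the number of
  distinct strings in the class. It is \<open>1\<close> for aperiodic necklaces, and \<open>3\<close> for \<open>111\<close>.
  This, and not the number of distinct strings, is the divisor \<open>d\<^sub>\<aa>\<close> with which a periodic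
  necklace enters \<open>log det (I - ZT)\<^sup>-\<^sup>1 = (\<Sum>n\<ge>1. Tr ((ZT)\<^sup>n) / n)\<close>.
\<close>

definition necklace_order :: "nat list \<Rightarrow> nat" where
  "necklace_order a = length a div necklace_period a"

definition necklaces :: "nat \<Rightarrow> (nat \<Rightarrow> nat) \<Rightarrow> nat list set" where
  "necklaces m i =
    {a. set a \<subseteq> {..<m} \<and> (\<forall>j<m. count_list a j = i j) \<and>
        (\<forall>b\<in>necklace a. lexordp_eq a b)}"

definition aperiodic_necklaces :: "nat \<Rightarrow> (nat \<Rightarrow> nat) \<Rightarrow> nat list set" where
  "aperiodic_necklaces m i = {a \<in> necklaces m i. necklace_period a = length a}"

section \<open>Formal power series in \<open>m\<close> variables\<close>

text \<open>
  A series is the family of its coefficients; only those at the indices in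
  \<open>multi_indices m\<close> are meaningful, and the Cauchy product at such an index
  only refers to such indices.
\<close>

type_synonym mseries = "(nat \<Rightarrow> nat) \<Rightarrow> complex"

definition mseries_one :: mseries where
  "mseries_one i = (if i = (\<lambda>_. 0) then 1 else 0)"

definition mseries_mult :: "mseries \<Rightarrow> mseries \<Rightarrow> mseries" where
  "mseries_mult f g i = (\<Sum>j | j \<le> i. f j * g (\<lambda>l. i l - j l))"

primrec mseries_power :: "mseries \<Rightarrow> nat \<Rightarrow> mseries" where
  "mseries_power f 0 = mseries_one"
| "mseries_power f (Suc n) = mseries_mult f (mseries_power f n)"

text \<open>
  If the constant coefficient of \<open>f\<close> vanishes, then the coefficients of \<open>f\<^sup>n\<close> at \<open>i\<close>
  vanish for all \<open>n > i\<^sub>1 + \<dots> + i\<^sub>m\<close>, so the sum below is finite.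
\<close>

definition mseries_exp :: "mseries \<Rightarrow> mseries" where
  "mseries_exp f i = suminf (\<lambda>n. mseries_power f n i / fact n)"

section \<open>Umbral calculus\<close>

text \<open>Polynomials with complex coefficients in a set \<open>'u\<close> of umbrae.\<close>

type_synonym 'u umbral_poly = "('u \<Rightarrow>\<^sub>0 nat) \<Rightarrow>\<^sub>0 complex"

definition umbra :: "'u \<Rightarrow> 'u umbral_poly" where
  "umbra \<alpha> = Poly_Mapping.single (Poly_Mapping.single \<alpha> 1) 1"

definition umbral_monomial :: "'u umbral_poly \<Rightarrow> bool" where
  "umbral_monomial q \<longleftrightarrow> (\<exists>k. q = Poly_Mapping.single k 1)"

text \<open>
  Factorization over distinct umbrae is not built into the functional: the components of a
  tuple like \<open>\<rho>\<close> may have arbitrary joint moments. It is imposed where the umbrae in question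
  are uncorrelated.
\<close>

definition evaluation_functional :: "('u umbral_poly \<Rightarrow> complex) \<Rightarrow> bool" where
  "evaluation_functional E \<longleftrightarrow>
     (\<forall>q r. E (q + r) = E q + E r) \<and>
     (\<forall>c q. E (Poly_Mapping.single 0 c * q) = c * E q) \<and>
     E 1 = 1"

definition tuple_power :: "nat \<Rightarrow> (nat \<Rightarrow> 'u umbral_poly) \<Rightarrow> (nat \<Rightarrow> nat) \<Rightarrow> 'u umbral_poly" where
  "tuple_power m \<nu> i = (\<Prod>j<m. \<nu> j ^ i j)"

definition umbral_gf ::
    "('u umbral_poly \<Rightarrow> complex) \<Rightarrow> nat \<Rightarrow> (nat \<Rightarrow> 'u umbral_poly) \<Rightarrow> mseries" where
  "umbral_gf E m \<nu> i = E (tuple_power m \<nu> i) / (\<Prod>j<m. fact (i j))"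

text \<open>
  The tuple \<open>\<kappa>\<close> is (a tuple of umbrae representing) the auxiliary tuple \<open>d . \<beta> . \<nu>\<close>,
  i.e. its generating function is \<open>exp (d (f(\<nu>, z) - 1))\<close>.
\<close>

definition represents_dot_bell ::
    "('u umbral_poly \<Rightarrow> complex) \<Rightarrow> nat \<Rightarrow> complex \<Rightarrow>
      (nat \<Rightarrow> 'u umbral_poly) \<Rightarrow> (nat \<Rightarrow> 'u umbral_poly) \<Rightarrow> bool" where
  "represents_dot_bell E m d \<nu> \<kappa> \<longleftrightarrow>
     (\<forall>i\<in>multi_indices m.
        umbral_gf E m \<kappa> i = mseries_exp (\<lambda>j. d * (umbral_gf E m \<nu> j - mseries_one j)) i)"

text \<open>
  The umbrae \<open>u j\<close> (\<open>j < m\<close>) are uncorrelated with each other and with the tuple \<open>\<rho>\<close>,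
  and all of them have moments \<open>n!\<close>.
\<close>

definition uncorrelated_factorial_umbrae ::
    "('u umbral_poly \<Rightarrow> complex) \<Rightarrow> nat \<Rightarrow> (nat \<Rightarrow> 'u) \<Rightarrow> (nat \<Rightarrow> 'u umbral_poly) \<Rightarrow> bool" where
  "uncorrelated_factorial_umbrae E m u \<rho> \<longleftrightarrow>
     (\<forall>j<m. \<forall>n. E (umbra (u j) ^ n) = fact n) \<and>
     (\<forall>i\<in>multi_indices m. \<forall>k\<in>multi_indices m.
        E (tuple_power m (\<lambda>j. umbra (u j)) i * tuple_power m \<rho> k) =
          (\<Prod>j<m. E (umbra (u j) ^ i j)) * E (tuple_power m \<rho> k))"

end

theory Submission
  imports Defs "HOL-Combinatorics.Cycles"
begin

text \<open>
  Choosing \<open>z = c e\<^sub>k\<close> with \<open>c\<close> small shows that \<open>p = m\<close> and that \<open>\<Sigma> H\<^sub>k\<close> is the matrix \<open>T\<close> with all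
  rows but the \<open>k\<close>-th replaced by zero. So the trace along a string \<open>a\<close> is the cyclic product
  \<open>t\<^bsub>a\<^sub>1,a\<^sub>2\<^esub> \<dots> t\<^bsub>a\<^sub>n,a\<^sub>1\<^esub>\<close>, and summing over the rotations in each class turns the necklace sum
  for the index \<open>k\<close> into \<open>1/|k|\<close> times the sum of the cyclic products over all words of kind \<open>k\<close>.
  Hence \<open>|k| h\<^sub>k\<close>, for \<open>h = d (f - 1)\<close>, is \<open>d\<close> times a sum over words. The Euler derivation gives
  \<open>|i| G\<^sub>i = (\<Sum>k\<le>i. |k| h\<^sub>k G\<^bsub>i-k\<^esub>)\<close> for \<open>G = exp h\<close>; splitting off the cycle of a marked point
  of a permutation shows that the \<open>d\<close>-permanent, divided by \<open>i!\<close>, satisfies the same recursion.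
\<close>

section \<open>Splitting off one cycle of a permutation\<close>

text \<open>Product of \<open>t\<close> along the closed walk through \<open>a\<close>; the
  \<open>mod\<close> supplies the step from the last letter back to the first. It serves both as the
  weight of one cycle of a permutation and as the trace along a string.\<close>

definition cyclic_weight :: "('a \<Rightarrow> 'a \<Rightarrow> complex) \<Rightarrow> 'a list \<Rightarrow> complex" where
  "cyclic_weight t a = (\<Prod>r<length a. t (a ! r) (a ! (Suc r mod length a)))"

text \<open>The \<open>d\<close>-permanent over an arbitrary index set, so that deleting the points
  of one cycle leaves an object of the same kind.\<close>

definition perm_sum :: "complex \<Rightarrow> ('a \<Rightarrow> 'a \<Rightarrow> complex) \<Rightarrow> 'a set \<Rightarrow> complex" where
  "perm_sum d t S = (\<Sum>\<sigma> | \<sigma> permutes S. d ^ card (orbit \<sigma> ` S) * (\<Prod>x\<in>S. t x (\<sigma> x)))"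

lemma cyclic_weight_map:
  "cyclic_weight t (map l xs) = cyclic_weight (\<lambda>x y. t (l x) (l y)) xs"
proof -
  have "Suc r mod length xs < length xs" if "r < length xs" for r
    using that by (intro mod_less_divisor) auto
  then show ?thesis
    by (auto simp: cyclic_weight_def intro!: prod.cong)
qed

text \<open>Rotation shifts the factor index from \<open>r\<close> to \<open>Suc r mod N\<close>, a
  bijection of \<open>{..<N}\<close>. So the weight depends only on the necklace.\<close>

lemma cyclic_weight_rotate:
  "cyclic_weight t (rotate n a) = cyclic_weight t a"
proof (induction n)
  case 0
  show ?case by simp
next
  case (Suc n)
  have "cyclic_weight t (rotate1 b) = cyclic_weight t b" for b :: "'a list"
  proof (cases "b = []")
    case False
    define N where "N = length b"
    have N: "N > 0" using False by (simp add: N_def)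
    have "cyclic_weight t (rotate1 b) =
        (\<Prod>r<N. t (b ! (Suc r mod N)) (b ! (Suc (Suc r mod N) mod N)))"
      using N by (auto simp: cyclic_weight_def N_def nth_rotate1 intro!: prod.cong)
    also have "\<dots> = (\<Prod>r<N. t (b ! r) (b ! (Suc r mod N)))"
    proof (rule prod.reindex_bij_betw[where h = "\<lambda>r. Suc r mod N" and g = "\<lambda>r. t (b ! r) (b ! (Suc r mod N))"])
      have "inj_on (\<lambda>r. Suc r mod N) {..<N}"
        by (auto simp: inj_on_def mod_Suc split: if_splits)
      moreover have "(\<lambda>r. Suc r mod N) ` {..<N} \<subseteq> {..<N}"
        using N by auto
      ultimately show "bij_betw (\<lambda>r. Suc r mod N) {..<N} {..<N}"
        by (simp add: bij_betw_def endo_inj_surj)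
    qed
    finally show ?thesis by (simp add: cyclic_weight_def N_def)
  qed simp
  with Suc show ?case by simp
qed

section \<open>Cycles written as lists\<close>

lemma cycle_of_list_nth:
  assumes "distinct xs" "r < length xs"
  shows "cycle_of_list xs (xs ! r) = xs ! (Suc r mod length xs)"
proof -
  have "map (cycle_of_list xs) xs ! r = rotate 1 xs ! r"
    using cyclic_rotation[OF assms(1), of 1] by simp
  then show ?thesis using assms by (simp add: nth_rotate1)
qed

lemma funpow_cycle_of_list_hd:
  assumes "distinct xs" "xs \<noteq> []"
  shows "(cycle_of_list xs ^^ n) (hd xs) = xs ! (n mod length xs)"
proof -
  have "map (cycle_of_list xs ^^ n) xs ! 0 = rotate n xs ! 0"
    using cyclic_rotation[OF assms(1), of n] by simp
  then show ?thesis using assms by (simp add: nth_rotate hd_conv_nth)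
qed

text \<open>Iterating from the head passes through every position, so the orbit of
  \<open>hd xs\<close> is the whole list; cyclicity carries this over to the other entries.\<close>

lemma orbit_cycle_of_list:
  assumes "distinct xs" "y \<in> set xs"
  shows "orbit (cycle_of_list xs) y = set xs"
proof -
  from assms have ne: "xs \<noteq> []" by auto
  have "orbit (cycle_of_list xs) (hd xs) = {xs ! (n mod length xs) |n. True}"
    unfolding orbit_altdef_permutation[OF permutation_of_cycle]
    using funpow_cycle_of_list_hd[OF assms(1) ne] by simp
  also have "\<dots> = set xs"
  proof
    show "{xs ! (n mod length xs) |n. True} \<subseteq> set xs" using ne by auto
    show "set xs \<subseteq> {xs ! (n mod length xs) |n. True}"
      by (smt (verit) in_set_conv_nth mem_Collect_eq mod_less subsetI)
  qed
  finally have hd: "orbit (cycle_of_list xs) (hd xs) = set xs" .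
  have "cyclic_on (cycle_of_list xs) (set xs)"
    using cyclic_on_orbit'[OF permutation_of_cycle, of xs "hd xs"] by (simp add: hd)
  then show ?thesis using assms(2) by (rule orbit_cyclic_eq3)
qed

section \<open>The product of a cycle and a permutation of the remaining points\<close>

context
  fixes S :: "'a set" and xs :: "'a list" and \<tau> :: "'a \<Rightarrow> 'a"
  assumes S: "finite S" and xs: "distinct xs" "xs \<noteq> []" "set xs \<subseteq> S"
    and \<tau>: "\<tau> permutes S - set xs"
begin

lemma cycle_of_list_comp_apply:
  "(cycle_of_list xs \<circ> \<tau>) y = (if y \<in> set xs then cycle_of_list xs y else \<tau> y)"
proof (cases "y \<in> set xs")
  case True
  then show ?thesis using permutes_not_in[OF \<tau>, of y] by simp
next
  case False
  then have "\<tau> y \<notin> set xs"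
    using permutes_in_image[OF \<tau>, of y] permutes_not_in[OF \<tau>, of y] by fastforce
  then show ?thesis using False by (simp add: id_outside_supp)
qed

lemma cycle_of_list_comp_permutes: "cycle_of_list xs \<circ> \<tau> permutes S"
  using permutes_compose[OF permutes_subset[OF \<tau>] permutes_subset[OF cycle_permutes xs(3)]]
  by auto

text \<open>The composite leaves both \<open>set xs\<close> and \<open>S - set xs\<close> invariant
  and agrees on each with one of the factors.\<close>

lemma orbit_cycle_of_list_comp:
  "orbit (cycle_of_list xs \<circ> \<tau>) y = (if y \<in> set xs then set xs else orbit \<tau> y)" if "y \<in> S"
proof (cases "y \<in> set xs")
  case True
  have "orbit (cycle_of_list xs \<circ> \<tau>) y = orbit (cycle_of_list xs) y"
    by (rule orbit_cong0[OF True])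
      (use cycle_of_list_comp_apply permutes_in_image[OF cycle_permutes, of xs] in auto)
  then show ?thesis using True orbit_cycle_of_list[OF xs(1) True] by simp
next
  case False
  have "orbit (cycle_of_list xs \<circ> \<tau>) y = orbit \<tau> y"
  proof (rule orbit_cong0)
    show "y \<in> S - set xs" using False that by simp
    show "cycle_of_list xs \<circ> \<tau> \<in> (S - set xs) \<rightarrow> (S - set xs)"
      using cycle_of_list_comp_apply permutes_in_image[OF \<tau>] by auto
    show "(cycle_of_list xs \<circ> \<tau>) z = \<tau> z" if "z \<in> S - set xs" for z
      using that cycle_of_list_comp_apply by auto
  qed
  then show ?thesis using False by simp
qed

text \<open>The orbits of \<tau> at the other points lie inside \<open>S - set xs\<close>, so
  \<open>set xs\<close> is exactly one new orbit. This produces the factor \<open>d\<close>.\<close>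

lemma card_orbits_cycle_of_list_comp:
  "card (orbit (cycle_of_list xs \<circ> \<tau>) ` S) = Suc (card (orbit \<tau> ` (S - set xs)))"
proof -
  have "orbit (cycle_of_list xs \<circ> \<tau>) ` S
      = orbit (cycle_of_list xs \<circ> \<tau>) ` set xs \<union> orbit (cycle_of_list xs \<circ> \<tau>) ` (S - set xs)"
    using xs(3) by blast
  also have "orbit (cycle_of_list xs \<circ> \<tau>) ` set xs = {set xs}"
    using xs orbit_cycle_of_list_comp by (force simp: subset_eq neq_Nil_conv)
  also have "orbit (cycle_of_list xs \<circ> \<tau>) ` (S - set xs) = orbit \<tau> ` (S - set xs)"
    using orbit_cycle_of_list_comp by auto
  finally have *: "orbit (cycle_of_list xs \<circ> \<tau>) ` S = insert (set xs) (orbit \<tau> ` (S - set xs))"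
    by (simp only: Un_insert_left sup_bot_left)
  have "set xs \<notin> orbit \<tau> ` (S - set xs)"
  proof
    assume "set xs \<in> orbit \<tau> ` (S - set xs)"
    then obtain y where "y \<in> S - set xs" "set xs = orbit \<tau> y" by auto
    then have "set xs \<subseteq> S - set xs"
      using permutes_orbit_subset[OF \<tau>] by simp
    then show False using xs(2) by (cases xs) auto
  qed
  then show ?thesis using S * by simp
qed

lemma prod_cycle_of_list_comp:
  "(\<Prod>x\<in>S. t x ((cycle_of_list xs \<circ> \<tau>) x)) = cyclic_weight t xs * (\<Prod>x\<in>S - set xs. t x (\<tau> x))"
proof -
  have "(\<Prod>x\<in>S. t x ((cycle_of_list xs \<circ> \<tau>) x))
      = (\<Prod>x\<in>S - set xs. t x ((cycle_of_list xs \<circ> \<tau>) x)) * (\<Prod>x\<in>set xs. t x ((cycle_of_list xs \<circ> \<tau>) x))"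
    by (rule prod.subset_diff[OF xs(3) S])
  also have "(\<Prod>x\<in>S - set xs. t x ((cycle_of_list xs \<circ> \<tau>) x)) = (\<Prod>x\<in>S - set xs. t x (\<tau> x))"
    using cycle_of_list_comp_apply by (auto intro!: prod.cong)
  also have "(\<Prod>x\<in>set xs. t x ((cycle_of_list xs \<circ> \<tau>) x)) = (\<Prod>x\<in>set xs. t x (cycle_of_list xs x))"
    using cycle_of_list_comp_apply by (auto intro!: prod.cong)
  also have "\<dots> = (\<Prod>r<length xs. t (xs ! r) (cycle_of_list xs (xs ! r)))"
    by (rule prod.reindex_bij_betw[symmetric, where h = "(!) xs"])
      (use bij_betw_nth[OF xs(1) refl refl] in simp)
  also have "\<dots> = cyclic_weight t xs"
    by (simp add: cyclic_weight_def cycle_of_list_nth[OF xs(1)])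
  finally show ?thesis by simp
qed

text \<open>Uniqueness of the splitting once the head is known: the list is read off the iterates of
  \<sigma> at \<open>hd xs\<close>, and \<tau> is what \<sigma> does elsewhere.\<close>

lemma cycle_of_list_comp_determines:
  defines "\<sigma> \<equiv> cycle_of_list xs \<circ> \<tau>"
  shows "xs = map (\<lambda>r. (\<sigma> ^^ r) (hd xs)) [0..<card (orbit \<sigma> (hd xs))]"
    and "\<tau> = perm_restrict \<sigma> (S - set xs)"
proof -
  \<comment> \<open>Starting at the head, the iterates stay in \<open>set xs\<close>, where \<sigma>
    acts as the cycle.\<close>
  have pow: "(\<sigma> ^^ r) (hd xs) = xs ! (r mod length xs)" for r
  proof -
    have "(\<sigma> ^^ r) (hd xs) = (cycle_of_list xs ^^ r) (hd xs)"
    proof (induction r)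
      case (Suc r)
      then show ?case
        using xs funpow_cycle_of_list_hd[OF xs(1,2)] cycle_of_list_comp_apply
        by (simp add: \<sigma>_def)
    qed simp
    then show ?thesis using funpow_cycle_of_list_hd[OF xs(1,2)] by simp
  qed
  have "orbit \<sigma> (hd xs) = set xs"
    using orbit_cycle_of_list_comp[of "hd xs"] xs hd_in_set[OF xs(2)]
    unfolding \<sigma>_def by (simp add: subset_iff)
  then show "xs = map (\<lambda>r. (\<sigma> ^^ r) (hd xs)) [0..<card (orbit \<sigma> (hd xs))]"
    by (intro nth_equalityI) (auto simp: pow distinct_card[OF xs(1)])
  show "\<tau> = perm_restrict \<sigma> (S - set xs)"
    using cycle_of_list_comp_apply permutes_not_in[OF \<tau>]
    by (force simp: perm_restrict_def \<sigma>_def)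
qed

end

text \<open>Existence of the splitting: \<open>xs\<close> lists the iterates of \<open>x\<close>
  before the first return, and \<tau> is \<sigma> made trivial on them.\<close>

lemma permutes_split_cycle:
  assumes S: "finite S" and \<sigma>: "\<sigma> permutes S" and x: "x \<in> S"
  obtains xs \<tau> where "distinct xs" "xs \<noteq> []" "set xs \<subseteq> S" "\<tau> permutes S - set xs"
    "hd xs = x" "\<sigma> = cycle_of_list xs \<circ> \<tau>"
proof -
  have perm: "permutation \<sigma>" using S \<sigma> permutation_permutes by blast
  define xs where "xs = support \<sigma> x"
  define \<tau> where "\<tau> = (\<lambda>y. if y \<in> S - set xs then \<sigma> y else y)"
  have lp: "least_power \<sigma> x > 0" by (rule least_power_of_permutation(2)[OF perm])
  have 1: "distinct xs" unfolding xs_def by (rule cycle_of_permutation[OF perm])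
  have 2: "xs \<noteq> []" using lp by (simp add: xs_def)
  have "set xs = orbit \<sigma> x"
    unfolding xs_def support_set[OF perm] orbit_altdef_permutation[OF perm] by auto
  then have 3: "set xs \<subseteq> S" using permutes_orbit_subset[OF \<sigma> x] by simp
  have 4: "\<tau> permutes S - set xs"
    unfolding \<tau>_def xs_def by (rule semidecomposition[OF \<sigma> S])
  have 5: "hd xs = x" using lp by (simp add: xs_def hd_map)
  have "\<sigma> y = (cycle_of_list xs \<circ> \<tau>) y" for y
    unfolding cycle_of_list_comp_apply[OF S 1 2 3 4]
    using cycle_restrict[OF perm, of y x] permutes_not_in[OF \<sigma>, of y]
    by (auto simp: \<tau>_def xs_def)
  then show thesis using that 1 2 3 4 5 by blast
qed

lemma finite_distinct_lists_subset: "finite S \<Longrightarrow> finite {xs. distinct xs \<and> set xs \<subseteq> S}"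
  by (rule finite_subset[OF _ finite_lists_length_le[of S "card S"]])
    (auto simp: distinct_card[symmetric] intro: card_mono)

text \<open>Both sides count permutations with a marked point; the list on the right traverses the
  cycle of the marked point, starting there.\<close>

lemma card_mult_perm_sum:
  assumes S: "finite S"
  shows "of_nat (card S) * perm_sum d t S =
    (\<Sum>xs | distinct xs \<and> xs \<noteq> [] \<and> set xs \<subseteq> S.
       d * cyclic_weight t xs * perm_sum d t (S - set xs))"
proof -
  define P where "P = (SIGMA xs : {xs. distinct xs \<and> xs \<noteq> [] \<and> set xs \<subseteq> S}. {\<tau>. \<tau> permutes S - set xs})"
  define j where "j = (\<lambda>(xs :: 'a list, \<tau> :: 'a \<Rightarrow> 'a). (hd xs, cycle_of_list xs \<circ> \<tau>))"
  define w where "w = (\<lambda>(x :: 'a, \<sigma> :: 'a \<Rightarrow> 'a). d ^ card (orbit \<sigma> ` S) * (\<Prod>x\<in>S. t x (\<sigma> x)))"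
  have bij: "bij_betw j P (S \<times> {\<sigma>. \<sigma> permutes S})"
  proof (rule bij_betw_imageI)
    show "inj_on j P"
    proof (rule inj_onI)
      fix p q assume "p \<in> P" "q \<in> P" and eq: "j p = j q"
      obtain xs \<tau> ys \<tau>' where p: "p = (xs, \<tau>)" "q = (ys, \<tau>')" by (cases p, cases q)
      note D = cycle_of_list_comp_determines[OF S]
      have xs: "distinct xs" "xs \<noteq> []" "set xs \<subseteq> S" "\<tau> permutes S - set xs"
        and ys: "distinct ys" "ys \<noteq> []" "set ys \<subseteq> S" "\<tau>' permutes S - set ys"
        using \<open>p \<in> P\<close> \<open>q \<in> P\<close> p by (auto simp: P_def)
      have "xs = ys"
        using D(1)[OF xs] D(1)[OF ys] eq by (simp add: p j_def)
      moreover have "\<tau> = \<tau>'"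
        using D(2)[OF xs] D(2)[OF ys] eq \<open>xs = ys\<close> by (simp add: p j_def)
      ultimately show "p = q" by (simp add: p)
    qed
    show "j ` P = S \<times> {\<sigma>. \<sigma> permutes S}"
    proof
      show "j ` P \<subseteq> S \<times> {\<sigma>. \<sigma> permutes S}"
        using cycle_of_list_comp_permutes[OF S] by (force simp: P_def j_def)
      show "S \<times> {\<sigma>. \<sigma> permutes S} \<subseteq> j ` P"
      proof (safe)
        fix x \<sigma> assume "x \<in> S" "\<sigma> permutes S"
        from permutes_split_cycle[OF S this(2,1)] show "(x, \<sigma>) \<in> j ` P"
          by (smt (verit) P_def SigmaI j_def case_prod_conv image_iff mem_Collect_eq)
      qed
    qed
  qed
  have fin: "finite {xs. distinct xs \<and> xs \<noteq> [] \<and> set xs \<subseteq> S}"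
    by (rule finite_subset[OF _ finite_distinct_lists_subset[OF S]]) auto
  \<comment> \<open>The weight \<open>w\<close> ignores the marked point, which accounts for the
    factor \<open>card S\<close>.\<close>
  have "of_nat (card S) * perm_sum d t S = (\<Sum>x\<in>S. \<Sum>\<sigma> | \<sigma> permutes S. w (x, \<sigma>))"
    by (simp add: perm_sum_def w_def)
  also have "\<dots> = (\<Sum>p\<in>S \<times> {\<sigma>. \<sigma> permutes S}. w p)"
    by (simp add: sum.cartesian_product)
  also have "\<dots> = (\<Sum>p\<in>P. w (j p))"
    by (rule sum.reindex_bij_betw[OF bij, symmetric])
  also have "\<dots> = (\<Sum>xs | distinct xs \<and> xs \<noteq> [] \<and> set xs \<subseteq> S. \<Sum>\<tau> | \<tau> permutes S - set xs. w (j (xs, \<tau>)))"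
    unfolding P_def by (subst sum.Sigma) (use fin S in \<open>auto simp: finite_permutations\<close>)
  also have "\<dots> = (\<Sum>xs | distinct xs \<and> xs \<noteq> [] \<and> set xs \<subseteq> S.
       d * cyclic_weight t xs * perm_sum d t (S - set xs))"
  proof (rule sum.cong[OF refl])
    fix xs assume xs: "xs \<in> {xs. distinct xs \<and> xs \<noteq> [] \<and> set xs \<subseteq> S}"
    have "w (j (xs, \<tau>)) = d * cyclic_weight t xs *
        (d ^ card (orbit \<tau> ` (S - set xs)) * (\<Prod>x\<in>S - set xs. t x (\<tau> x)))"
      if "\<tau> permutes S - set xs" for \<tau>
      using xs that card_orbits_cycle_of_list_comp[OF S _ _ _ that]
        prod_cycle_of_list_comp[OF S _ _ _ that]
      by (simp add: w_def j_def del: comp_apply)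
    then show "(\<Sum>\<tau> | \<tau> permutes S - set xs. w (j (xs, \<tau>))) =
        d * cyclic_weight t xs * perm_sum d t (S - set xs)"
      by (simp add: perm_sum_def sum_distrib_left)
  qed
  finally show ?thesis .
qed

section \<open>Necklaces as rotation classes of words\<close>

definition words :: "nat \<Rightarrow> (nat \<Rightarrow> nat) \<Rightarrow> nat list set" where
  "words m k = {b. set b \<subseteq> {..<m} \<and> (\<forall>j<m. count_list b j = k j)}"

lemma count_list_rotate: "count_list (rotate n a) x = count_list a x"
proof -
  have "count_list a x = count_list (take (n mod length a) a @ drop (n mod length a) a) x"
    by simp
  then show ?thesis
    unfolding rotate_drop_take count_list_append by simp
qed

lemma rotate_in_words: "rotate n b \<in> words m k \<longleftrightarrow> b \<in> words m k"
  by (simp add: words_def count_list_rotate)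

lemma length_words: "b \<in> words m k \<Longrightarrow> length b = (\<Sum>j<m. k j)"
  using sum_count_set[of b "{..<m}"] by (auto simp: words_def)

lemma finite_words: "finite (words m k)"
  by (rule finite_subset[OF _ finite_lists_length_eq[of "{..<m}" "\<Sum>j<m. k j"]])
    (auto simp: length_words, auto simp: words_def)

lemma rotate_rotate_inverse: "rotate (length a - n mod length a) (rotate n a) = a"
proof (cases "a = []")
  case False
  then have "length a - n mod length a + n = length a + n div length a * length a"
    by (simp add: minus_mod_eq_div_mult[symmetric] order_less_imp_le)
  then have "(length a - n mod length a + n) mod length a = 0" by simp
  then show ?thesis by (simp add: rotate_rotate)
qed simp

section \<open>Rotation classes, their sizes and their representatives\<close>

lemma self_in_necklace: "a \<in> necklace a"
  unfolding necklace_def by (rule range_eqI[of _ _ 0]) simp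

lemma necklace_eq: "b \<in> necklace a \<Longrightarrow> necklace b = necklace a"
proof -
  have sub: "necklace b \<subseteq> necklace a" if "b \<in> necklace a" for a b :: "nat list"
    using that by (auto simp: necklace_def rotate_rotate)
  assume b: "b \<in> necklace a"
  then obtain n where "b = rotate n a" by (auto simp: necklace_def)
  then have "a \<in> necklace b"
    using rotate_rotate_inverse[of a n] by (metis necklace_def rangeI)
  with b sub show ?thesis by blast
qed

lemma necklace_eq_image: "a \<noteq> [] \<Longrightarrow> necklace a = (\<lambda>r. rotate r a) ` {..<length a}"
  unfolding necklace_def by (auto simp: image_iff) (metis length_greater_0_conv lessThan_iff mod_less_divisor rotate_conv_mod)

lemma finite_necklace: "finite (necklace a)"
  by (cases "a = []") (simp add: necklace_def, simp add: necklace_eq_image)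

text \<open>Rotation by \<open>s\<close> injects the shifts producing \<open>b\<close> into those
  producing \<open>rotate s b\<close>, so every string of the class arises from equally many of the
  \<open>length a\<close> shifts. Hence the truncating division in \<open>necklace_order\<close> is
  exact.\<close>

lemma necklace_period_mult_order:
  assumes "a \<noteq> []"
  shows "necklace_period a * necklace_order a = length a"
proof -
  define n where "n = length a"
  have n: "n > 0" using assms by (simp add: n_def)
  define fib where "fib = (\<lambda>b. {r \<in> {..<n}. rotate r a = b})"
  have le: "card (fib b) \<le> card (fib (rotate s b))" for b s
  proof (rule card_inj_on_le)
    have s: "s + (n - s mod n) = n + s div n * n"
      using n by (simp add: minus_mod_eq_div_mult[symmetric] order_less_imp_le)
    have "((s + r) mod n + (n - s mod n)) mod n = r" if "r < n" for r
    proof -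
      have "((s + r) mod n + (n - s mod n)) mod n = (r + (s + (n - s mod n))) mod n"
        by (simp add: mod_simps ac_simps)
      also have "\<dots> = r" unfolding s using that by (simp flip: add.assoc)
      finally show ?thesis .
    qed
    \<comment> \<open>Adding \<open>n - s mod n\<close> modulo \<open>n\<close> undoes adding
      \<open>s\<close>.\<close>
    then show "inj_on (\<lambda>r. (s + r) mod n) (fib b)"
      by (intro inj_on_inverseI[where g = "\<lambda>q. (q + (n - s mod n)) mod n"]) (auto simp: fib_def)
    show "(\<lambda>r. (s + r) mod n) ` fib b \<subseteq> fib (rotate s b)"
      using n by (auto simp: fib_def n_def rotate_rotate rotate_conv_mod[symmetric])
    show "finite (fib (rotate s b))" by (simp add: fib_def)
  qed
  \<comment> \<open>The inequality for a rotation and for its inverse gives equal fibre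
    sizes.\<close>
  have eq: "card (fib b) = card (fib a)" if "b \<in> necklace a" for b
  proof -
    from that obtain s where b: "b = rotate s a" by (auto simp: necklace_def)
    show ?thesis
      using le[of a s] le[of b "n - s mod n"] rotate_rotate_inverse[of a s] by (simp add: b n_def)
  qed
  have "n = (\<Sum>r<n. 1)" by simp
  also have "\<dots> = (\<Sum>b\<in>(\<lambda>r. rotate r a) ` {..<n}. \<Sum>r | r \<in> {..<n} \<and> rotate r a = b. 1)"
    by (rule sum.image_gen) simp
  also have "\<dots> = (\<Sum>b\<in>necklace a. card (fib b))"
    using necklace_eq_image[OF assms] by (simp add: n_def fib_def)
  also have "\<dots> = necklace_period a * card (fib a)"
    using eq by (simp add: necklace_period_def)
  finally have *: "n = necklace_period a * card (fib a)" .
  then show ?thesis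
    using n by (simp add: necklace_order_def n_def[symmetric])
qed

text \<open>A rotation class is finite and nonempty, so it has a lexicographically least string, and
  rotation preserves letter counts.\<close>

lemma words_eq_UN_necklaces: "words m k = (\<Union>a\<in>necklaces m k. necklace a)"
proof
  show "(\<Union>a\<in>necklaces m k. necklace a) \<subseteq> words m k"
  proof safe
    fix a b assume "a \<in> necklaces m k" "b \<in> necklace a"
    then have "a \<in> words m k" "\<exists>n. b = rotate n a"
      by (auto simp: necklaces_def words_def necklace_def)
    then show "b \<in> words m k" using rotate_in_words by blast
  qed
next
  show "words m k \<subseteq> (\<Union>a\<in>necklaces m k. necklace a)"
  proof
    fix b assume b: "b \<in> words m k"
    interpret lex: linorder "lexordp_eq :: nat list \<Rightarrow> nat list \<Rightarrow> bool" ord_class.lexordp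
      by (rule lexordp_linorder)
    obtain a where a: "a \<in> necklace b" "\<forall>x\<in>necklace b. lexordp_eq a x"
      using lex.Min_in[OF finite_necklace] lex.Min_le[OF finite_necklace] self_in_necklace
      by blast
    have "necklace a = necklace b" by (rule necklace_eq[OF a(1)])
    moreover have "a \<in> words m k"
      using a(1) b rotate_in_words by (auto simp: necklace_def)
    ultimately have "a \<in> necklaces m k"
      using a(2) by (auto simp: necklaces_def words_def)
    then show "b \<in> (\<Union>a\<in>necklaces m k. necklace a)"
      using \<open>necklace a = necklace b\<close> self_in_necklace by blast
  qed
qed

lemma finite_necklaces: "finite (necklaces m k)"
  by (rule finite_subset[OF _ finite_words]) (auto simp: necklaces_def words_def)

lemma necklaces_disjoint:
  assumes "a \<in> necklaces m k" "b \<in> necklaces m k" "a \<noteq> b"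
  shows "necklace a \<inter> necklace b = {}"
proof (rule ccontr)
  assume "necklace a \<inter> necklace b \<noteq> {}"
  then have "necklace a = necklace b" using necklace_eq by blast
  then have "lexordp_eq a b" "lexordp_eq b a"
    using assms self_in_necklace by (auto simp: necklaces_def)
  then show False using assms(3) lexordp_eq_antisym by blast
qed

text \<open>A class of period \<open>s\<close> and order \<open>q\<close> contributes
  \<open>s * f a\<close> to the sum over words. Since \<open>s * q\<close> is the length, this is
  the length times \<open>f a / q\<close>.\<close>

lemma sum_necklaces_eq_sum_words:
  fixes f :: "nat list \<Rightarrow> complex"
  assumes f: "\<And>n a. f (rotate n a) = f a" and k: "(\<Sum>j<m. k j) \<noteq> 0"
  shows "of_nat (\<Sum>j<m. k j) *
      ((\<Sum>a\<in>aperiodic_necklaces m k. f a) +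
       (\<Sum>a\<in>necklaces m k - aperiodic_necklaces m k. 1 / of_nat (necklace_order a) * f a)) =
    (\<Sum>b\<in>words m k. f b)"
proof -
  have sub: "aperiodic_necklaces m k \<subseteq> necklaces m k" by (auto simp: aperiodic_necklaces_def)
  have len: "length a = (\<Sum>j<m. k j)" "a \<noteq> []" if "a \<in> necklaces m k" for a
  proof -
    have "a \<in> words m k" using that by (auto simp: necklaces_def words_def)
    from length_words[OF this] show "length a = (\<Sum>j<m. k j)" .
    then show "a \<noteq> []" using k by auto
  qed
  \<comment> \<open>Aperiodic classes have order 1, so the two sums merge into one with a common
    summand.\<close>
  have "(\<Sum>j<m. k j) div (\<Sum>j<m. k j) = 1" using k by (rule div_self)
  then have "(\<Sum>a\<in>aperiodic_necklaces m k. f a) =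
      (\<Sum>a\<in>aperiodic_necklaces m k. 1 / of_nat (necklace_order a) * f a)"
    using len by (auto simp: aperiodic_necklaces_def necklace_order_def intro!: sum.cong)
  then have "(\<Sum>a\<in>aperiodic_necklaces m k. f a) +
       (\<Sum>a\<in>necklaces m k - aperiodic_necklaces m k. 1 / of_nat (necklace_order a) * f a) =
     (\<Sum>a\<in>necklaces m k. 1 / of_nat (necklace_order a) * f a)"
    by (simp only: add.commute
        sum.subset_diff[OF sub finite_necklaces, of "\<lambda>a. 1 / of_nat (necklace_order a) * f a"])
  moreover have "of_nat (\<Sum>j<m. k j) * (1 / of_nat (necklace_order a) * f a) = (\<Sum>b\<in>necklace a. f b)"
    if "a \<in> necklaces m k" for a
  proof -
    have *: "(\<Sum>j<m. k j) = necklace_period a * necklace_order a"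
      using necklace_period_mult_order len[OF that] by simp
    have "f b = f a" if "b \<in> necklace a" for b
      using that f by (auto simp: necklace_def)
    then have "(\<Sum>b\<in>necklace a. f b) = of_nat (necklace_period a) * f a"
      by (simp add: necklace_period_def)
    then show ?thesis using k unfolding * by simp
  qed
  ultimately show ?thesis
    unfolding words_eq_UN_necklaces
    by (subst sum.UNION_disjoint)
      (use finite_necklaces finite_necklace necklaces_disjoint in \<open>auto simp: sum_distrib_left\<close>)
qed

section \<open>The Euler derivation on power series\<close>

definition index_degree :: "nat \<Rightarrow> (nat \<Rightarrow> nat) \<Rightarrow> nat" where
  "index_degree m i = (\<Sum>j<m. i j)"

lemma index_degree_zero [simp]: "index_degree m (\<lambda>_. 0) = 0"
  by (simp add: index_degree_def)

lemma index_degree_eq_0_iff: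
  "i \<in> multi_indices m \<Longrightarrow> index_degree m i = 0 \<longleftrightarrow> i = (\<lambda>_. 0)"
  by (auto simp: index_degree_def multi_indices_def fun_eq_iff)
    (metis lessThan_iff not_le)

lemma index_degree_diff:
  "j \<le> i \<Longrightarrow> index_degree m i = index_degree m j + index_degree m (\<lambda>l. i l - j l)"
  by (simp add: index_degree_def le_fun_def flip: sum.distrib)

lemma multi_indices_le: "i \<in> multi_indices m \<Longrightarrow> j \<le> i \<Longrightarrow> j \<in> multi_indices m"
  by (auto simp: multi_indices_def le_fun_def) (metis le_zero_eq)

lemma multi_indices_diff: "i \<in> multi_indices m \<Longrightarrow> (\<lambda>l. i l - j l) \<in> multi_indices m"
  by (auto simp: multi_indices_def)

text \<open>Holds because \<open>i\<close> vanishes from \<open>m\<close> on. It keeps Cauchy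
  products meaningful, as a sum over an infinite set is 0 by convention.\<close>

lemma finite_indices_le:
  assumes "i \<in> multi_indices m"
  shows "finite {j. j \<le> i}"
proof (rule finite_subset)
  show "{j. j \<le> i} \<subseteq> {f. \<forall>x. (x \<in> {..<m} \<longrightarrow> f x \<in> {..index_degree m i}) \<and> (x \<notin> {..<m} \<longrightarrow> f x = 0)}"
  proof
    fix j assume "j \<in> {j. j \<le> i}"
    then have j: "j \<le> i" by simp
    have "j x \<le> index_degree m i" if x: "x < m" for x
    proof -
      have "j x \<le> i x" using j by (simp add: le_fun_def)
      also have "\<dots> \<le> index_degree m i"
        unfolding index_degree_def using x by (intro member_le_sum) auto
      finally show ?thesis .
    qed
    moreover have "j x = 0" if "x \<ge> m" for x
      using multi_indices_le[OF assms j] that by (simp add: multi_indices_def)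
    ultimately show "j \<in> {f. \<forall>x. (x \<in> {..<m} \<longrightarrow> f x \<in> {..index_degree m i}) \<and> (x \<notin> {..<m} \<longrightarrow> f x = 0)}"
      by simp
  qed
  show "finite {f. \<forall>x. (x \<in> {..<m} \<longrightarrow> f x \<in> {..index_degree m i}) \<and> (x \<notin> {..<m} \<longrightarrow> f x = 0)}"
    by (intro finite_set_of_finite_funs) auto
qed

text \<open>Both sides sum over pairs with \<open>a + b \<le> i\<close>; only the order of summation
  differs. This one law supplies the associativity and commutativity behind the power rule.\<close>

lemma mseries_mult_left_commute:
  assumes i: "i \<in> multi_indices m"
  shows "mseries_mult f (mseries_mult g h) i = mseries_mult g (mseries_mult f h) i"
proof -
  define A where "A = {j. j \<le> i}"
  have A: "finite A" unfolding A_def by (rule finite_indices_le[OF i])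
  have set_eq: "{b. b \<le> (\<lambda>l. i l - a l)} = {b \<in> A. \<forall>l. a l + b l \<le> i l}" if "a \<in> A" for a
  proof -
    \<comment> \<open>Subtraction is truncated, so the equivalence relies on
      \<open>a l \<le> i l\<close>.\<close>
    have "b l \<le> i l - a l \<longleftrightarrow> a l + b l \<le> i l" for b l
    proof -
      have "a l \<le> i l" using that by (simp add: A_def le_fun_def)
      then show ?thesis by linarith
    qed
    moreover have "b \<in> A" if "\<forall>l. a l + b l \<le> i l" for b
      using that by (auto simp: A_def le_fun_def intro: add_leD2)
    ultimately show ?thesis by (auto simp: le_fun_def)
  qed
  have expand: "mseries_mult f (mseries_mult g h) i =
      (\<Sum>a\<in>A. \<Sum>b | b \<in> A \<and> (\<forall>l. a l + b l \<le> i l). f a * g b * h (\<lambda>l. i l - a l - b l))" for f g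
    unfolding mseries_mult_def A_def[symmetric]
    by (intro sum.cong refl) (simp add: set_eq sum_distrib_left mult.assoc)
  have "(\<Sum>a\<in>A. \<Sum>b | b \<in> A \<and> (\<forall>l. a l + b l \<le> i l). f a * g b * h (\<lambda>l. i l - a l - b l)) =
      (\<Sum>b\<in>A. \<Sum>a | a \<in> A \<and> (\<forall>l. a l + b l \<le> i l). f a * g b * h (\<lambda>l. i l - a l - b l))"
    by (rule sum.swap_restrict[OF A A])
  also have "\<dots> = (\<Sum>b\<in>A. \<Sum>a | a \<in> A \<and> (\<forall>l. b l + a l \<le> i l). g b * f a * h (\<lambda>l. i l - b l - a l))"
  proof (intro sum.cong refl)
    fix a b
    show "{a \<in> A. \<forall>l. a l + b l \<le> i l} = {a \<in> A. \<forall>l. b l + a l \<le> i l}"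
      by (simp only: add.commute)
    have "(\<lambda>l. i l - a l - b l) = (\<lambda>l. i l - b l - a l)"
      by (rule ext) linarith
    then show "f a * g b * h (\<lambda>l. i l - a l - b l) = g b * f a * h (\<lambda>l. i l - b l - a l)"
      by (simp only: mult.commute)
  qed
  finally show ?thesis unfolding expand .
qed

lemma mseries_mult_cong:
  assumes "\<And>j. j \<le> i \<Longrightarrow> f j = f' j" "\<And>j. j \<le> i \<Longrightarrow> g j = g' j"
  shows "mseries_mult f g i = mseries_mult f' g' i"
  unfolding mseries_mult_def by (intro sum.cong) (use assms in \<open>auto simp: le_fun_def\<close>)

text \<open>The operator \<open>z_1 d/dz_1 + ... + z_m d/dz_m\<close>, acting on
  coefficients.\<close>

definition euler_deriv :: "nat \<Rightarrow> mseries \<Rightarrow> mseries" where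
  "euler_deriv m f i = of_nat (index_degree m i) * f i"

text \<open>Leibniz rule: the degree is additive when \<open>i\<close> is split into
  \<open>j\<close> and \<open>i - j\<close>.\<close>

lemma euler_deriv_mult:
  "euler_deriv m (mseries_mult f g) i = mseries_mult (euler_deriv m f) g i + mseries_mult f (euler_deriv m g) i"
  unfolding euler_deriv_def mseries_mult_def sum_distrib_left sum.distrib[symmetric]
proof (intro sum.cong refl)
  fix j assume "j \<in> {j. j \<le> i}"
  then have *: "index_degree m i = index_degree m j + index_degree m (\<lambda>l. i l - j l)"
    by (simp add: index_degree_diff)
  show "of_nat (index_degree m i) * (f j * g (\<lambda>l. i l - j l)) =
      of_nat (index_degree m j) * f j * g (\<lambda>l. i l - j l) +
      f j * (of_nat (index_degree m (\<lambda>l. i l - j l)) * g (\<lambda>l. i l - j l))"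
    unfolding * by (simp add: algebra_simps)
qed

text \<open>Induction by the Leibniz rule; left commutation moves the differentiated factor to the
  front.\<close>

lemma euler_deriv_power_Suc:
  assumes "i \<in> multi_indices m"
  shows "euler_deriv m (mseries_power h (Suc n)) i =
    of_nat (Suc n) * mseries_mult (euler_deriv m h) (mseries_power h n) i"
  using assms
proof (induction n arbitrary: i)
  case 0
  \<comment> \<open>The series \<open>mseries_one\<close> lives in degree 0, so its Euler derivative
    vanishes.\<close>
  have "mseries_mult h (euler_deriv m mseries_one) i = 0"
    unfolding mseries_mult_def euler_deriv_def mseries_one_def by (intro sum.neutral) auto
  then show ?case by (simp add: euler_deriv_mult)
next
  case (Suc n)
  have "mseries_mult h (euler_deriv m (mseries_power h (Suc n))) i =
      mseries_mult h (\<lambda>j. of_nat (Suc n) * mseries_mult (euler_deriv m h) (mseries_power h n) j) i"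
    by (rule mseries_mult_cong[OF refl]) (use Suc multi_indices_le in blast)
  also have "\<dots> = of_nat (Suc n) * mseries_mult h (mseries_mult (euler_deriv m h) (mseries_power h n)) i"
    unfolding mseries_mult_def[of h] by (simp add: sum_distrib_left mult_ac)
  also have "\<dots> = of_nat (Suc n) * mseries_mult (euler_deriv m h) (mseries_power h (Suc n)) i"
    unfolding mseries_mult_left_commute[OF Suc.prems, of h] by simp
  finally show ?case
    by (subst mseries_power.simps) (simp add: euler_deriv_mult algebra_simps del: mseries_power.simps)
qed

text \<open>Without a constant term, each of the \<open>n\<close> factors has degree at least
  one.\<close>

lemma mseries_power_eq_0:
  assumes "h (\<lambda>_. 0) = 0" "i \<in> multi_indices m" "index_degree m i < n"
  shows "mseries_power h n i = 0"
  using assms(2,3)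
proof (induction n arbitrary: i)
  case (Suc n)
  have "h j * mseries_power h n (\<lambda>l. i l - j l) = 0" if j: "j \<le> i" for j
  proof (cases "j = (\<lambda>_. 0)")
    case True
    then show ?thesis using assms(1) by simp
  next
    case False
    then have "index_degree m j > 0"
      using index_degree_eq_0_iff[OF multi_indices_le[OF Suc.prems(1) j]] by simp
    then have "index_degree m (\<lambda>l. i l - j l) < n"
      using index_degree_diff[OF j, of m] Suc.prems(2) by simp
    then show ?thesis using Suc.IH[OF multi_indices_diff[OF Suc.prems(1)]] by simp
  qed
  then show ?case by (auto simp only: mseries_power.simps mseries_mult_def intro!: sum.neutral)
qed simp

text \<open>The free bound \<open>N\<close> lets one truncation serve an index and all smaller
  ones.\<close>

lemma mseries_exp_eq_sum:
  assumes "h (\<lambda>_. 0) = 0" "i \<in> multi_indices m" "index_degree m i < N"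
  shows "mseries_exp h i = (\<Sum>n<N. mseries_power h n i / fact n)"
  unfolding mseries_exp_def
  by (rule suminf_finite) (use assms mseries_power_eq_0[where h = h, OF assms(1,2)] in auto)

lemma mseries_exp_zero: "h (\<lambda>_. 0) = 0 \<Longrightarrow> mseries_exp h (\<lambda>_. 0) = 1"
  using mseries_exp_eq_sum[of h "\<lambda>_. 0" 0 1]
  by (simp add: multi_indices_def mseries_one_def)

text \<open>Coefficient form of \<open>D (exp h) = (D h) * exp h\<close> for the Euler derivation
  \<open>D\<close>, obtained termwise from the power rule.\<close>

lemma euler_deriv_mseries_exp:
  assumes h: "h (\<lambda>_. 0) = 0" and i: "i \<in> multi_indices m"
  shows "of_nat (index_degree m i) * mseries_exp h i =
    (\<Sum>j | j \<le> i. of_nat (index_degree m j) * h j * mseries_exp h (\<lambda>l. i l - j l))"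
proof -
  define N where "N = Suc (index_degree m i)"
  \<comment> \<open>Truncating at \<open>Suc N\<close> leaves \<open>N\<close> terms once the
    constant power \<open>n = 0\<close> is annihilated.\<close>
  have "of_nat (index_degree m i) * mseries_exp h i =
      (\<Sum>n<Suc N. euler_deriv m (mseries_power h n) i / fact n)"
    by (simp only: mseries_exp_eq_sum[where h = h, OF h i, of "Suc N"] N_def sum_distrib_left
        euler_deriv_def times_divide_eq_right less_Suc_eq simp_thms)
  also have "\<dots> = (\<Sum>n<N. euler_deriv m (mseries_power h (Suc n)) i / fact (Suc n))"
    unfolding sum.lessThan_Suc_shift
    by (auto simp: euler_deriv_def mseries_one_def simp del: mseries_power.simps(2) fact_Suc)
  also have "\<dots> = (\<Sum>n<N. mseries_mult (euler_deriv m h) (mseries_power h n) i / fact n)"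
    unfolding euler_deriv_power_Suc[OF i] by (simp add: field_simps del: of_nat_Suc)
  also have "\<dots> = (\<Sum>n<N. \<Sum>j | j \<le> i. euler_deriv m h j * (mseries_power h n (\<lambda>l. i l - j l) / fact n))"
    by (simp add: mseries_mult_def sum_divide_distrib)
  also have "\<dots> = (\<Sum>j | j \<le> i. euler_deriv m h j * (\<Sum>n<N. mseries_power h n (\<lambda>l. i l - j l) / fact n))"
    by (subst sum.swap) (simp add: sum_distrib_left)
  also have "\<dots> = (\<Sum>j | j \<le> i. euler_deriv m h j * mseries_exp h (\<lambda>l. i l - j l))"
  proof (intro sum.cong refl)
    fix j assume "j \<in> {j. j \<le> i}"
    then have "index_degree m (\<lambda>l. i l - j l) < N"
      using index_degree_diff[of j i m] by (simp add: N_def)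
    then show "euler_deriv m h j * (\<Sum>n<N. mseries_power h n (\<lambda>l. i l - j l) / fact n) =
        euler_deriv m h j * mseries_exp h (\<lambda>l. i l - j l)"
      using mseries_exp_eq_sum[where h = h, OF h multi_indices_diff[OF i]] by simp
  qed
  finally show ?thesis by (simp add: euler_deriv_def)
qed

section \<open>The exponential formula for coloured permutations\<close>

text \<open>The colour \<open>l x\<close> is the index of \<open>T\<close> that the point
  \<open>x\<close> copies. A set of points thus has a kind, from which a removed cycle subtracts the
  kind of its word.\<close>

definition colour_count :: "('a \<Rightarrow> nat) \<Rightarrow> 'a set \<Rightarrow> nat \<Rightarrow> nat" where
  "colour_count l S k = card {x \<in> S. l x = k}"

lemma colour_count_in_multi_indices: "l ` S \<subseteq> {..<m} \<Longrightarrow> colour_count l S \<in> multi_indices m"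
  by (fastforce simp: multi_indices_def colour_count_def card_eq_0_iff)

lemma index_degree_colour_count:
  assumes "finite S" "l ` S \<subseteq> {..<m}"
  shows "index_degree m (colour_count l S) = card S"
proof -
  have "card S = (\<Sum>k<m. \<Sum>x | x \<in> S \<and> l x = k. 1)"
    using assms by (subst sum.group) auto
  then show ?thesis by (simp add: index_degree_def colour_count_def)
qed

lemma colour_count_remove:
  assumes "finite S" "x \<in> S"
  shows "colour_count l (S - {x}) k = colour_count l S k - (if l x = k then 1 else 0)"
proof -
  have "{y \<in> S - {x}. l y = k} = {y \<in> S. l y = k} - {x}" by auto
  then show ?thesis using assms by (simp add: colour_count_def)
qed

lemma colour_count_set:
  assumes "distinct xs"
  shows "colour_count l (set xs) k = count_list (map l xs) k"
proof -
  have "{x \<in> set xs. l x = k} = set (filter (\<lambda>x. l x = k) xs)" by auto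
  then have "colour_count l (set xs) k = length (filter (\<lambda>x. l x = k) xs)"
    using assms by (simp only: colour_count_def distinct_card distinct_filter)
  also have "\<dots> = count_list (map l xs) k" by (induction xs) auto
  finally show ?thesis .
qed

lemma colour_count_diff:
  assumes "finite S" "distinct xs" "set xs \<subseteq> S"
  shows "colour_count l (S - set xs) k = colour_count l S k - count_list (map l xs) k"
    and "count_list (map l xs) k \<le> colour_count l S k"
proof -
  have eq: "{x \<in> S - set xs. l x = k} = {x \<in> S. l x = k} - {x \<in> set xs. l x = k}" by auto
  show "colour_count l (S - set xs) k = colour_count l S k - count_list (map l xs) k"
    unfolding colour_count_set[OF assms(2), symmetric] unfolding colour_count_def eq
    by (rule card_Diff_subset) (use assms in auto)
  show "count_list (map l xs) k \<le> colour_count l S k"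
    unfolding colour_count_set[OF assms(2), symmetric] unfolding colour_count_def
    by (rule card_mono) (use assms in auto)
qed

text \<open>The entries of \<open>xs\<close> are chosen one by one, each among the remaining points
  of its colour. This gives falling factorials, here with denominators cleared to stay in the
  naturals.\<close>

lemma card_lists_with_colours:
  assumes "finite S" "\<And>k. k < m \<Longrightarrow> count_list b k \<le> colour_count l S k" "set b \<subseteq> {..<m}"
  shows "card {xs. distinct xs \<and> set xs \<subseteq> S \<and> map l xs = b} *
      (\<Prod>k<m. fact (colour_count l S k - count_list b k)) = (\<Prod>k<m. fact (colour_count l S k) :: nat)"
  using assms
proof (induction b arbitrary: S)
  case Nil
  have "{xs. distinct xs \<and> set xs \<subseteq> S \<and> map l xs = []} = {[]}" by auto
  then show ?case by simp
next
  case (Cons c b)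
  define L where "L = (\<lambda>S. {xs. distinct xs \<and> set xs \<subseteq> S \<and> map l xs = b})"
  define P where "P = (\<Prod>k<m. fact (colour_count l S k - count_list (c # b) k) :: nat)"
  have c: "c < m" using Cons.prems by simp
  have pos: "colour_count l S c > 0" using Cons.prems(2)[OF c] by simp
  have finL: "finite (L (S - {x}))" for x
    by (rule finite_subset[OF _ finite_distinct_lists_subset[of S]]) (use Cons.prems in \<open>auto simp: L_def\<close>)
  have "{xs. distinct xs \<and> set xs \<subseteq> S \<and> map l xs = c # b} =
      (\<Union>x\<in>{x \<in> S. l x = c}. (#) x ` L (S - {x}))"
    by (auto simp: L_def map_eq_Cons_conv image_iff)
  then have "card {xs. distinct xs \<and> set xs \<subseteq> S \<and> map l xs = c # b} =
      (\<Sum>x | x \<in> S \<and> l x = c. card ((#) x ` L (S - {x})))"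
    using Cons.prems(1) finL by (simp only:) (rule card_UN_disjoint, auto)
  also have "\<dots> = (\<Sum>x | x \<in> S \<and> l x = c. card (L (S - {x})))"
    by (intro sum.cong refl card_image) (simp add: inj_on_def)
  finally have "card {xs. distinct xs \<and> set xs \<subseteq> S \<and> map l xs = c # b} * P =
      (\<Sum>x | x \<in> S \<and> l x = c. card (L (S - {x})) * P)"
    by (simp add: sum_distrib_right)
  also have "\<dots> = (\<Sum>x | x \<in> S \<and> l x = c. \<Prod>k<m. fact (colour_count l S k - (if c = k then 1 else 0)))"
  proof (intro sum.cong refl)
    fix x assume x: "x \<in> {x. x \<in> S \<and> l x = c}"
    then have cc: "colour_count l (S - {x}) k = colour_count l S k - (if c = k then 1 else 0)" for k
      using colour_count_remove[OF Cons.prems(1), of x l k] by simp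
    have "card (L (S - {x})) * (\<Prod>k<m. fact (colour_count l (S - {x}) k - count_list b k)) =
        (\<Prod>k<m. fact (colour_count l (S - {x}) k))"
      unfolding L_def
    proof (rule Cons.IH)
      show "count_list b k \<le> colour_count l (S - {x}) k" if "k < m" for k
        using Cons.prems(2)[OF that] by (auto simp: cc split: if_splits)
    qed (use Cons.prems in auto)
    \<comment> \<open>Removing \<open>x\<close> from \<open>S\<close> balances dropping the letter
      \<open>c\<close> from the word.\<close>
    moreover have "(\<Prod>k<m. fact (colour_count l (S - {x}) k - count_list b k)) = P"
      unfolding P_def by (intro prod.cong) (auto simp: cc)
    ultimately show "card (L (S - {x})) * P =
        (\<Prod>k<m. fact (colour_count l S k - (if c = k then 1 else 0)))"
      by (simp only: cc)
  qed
  \<comment> \<open>The summand is the same for every admissible first entry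
    \<open>x\<close>.\<close>
  also have "\<dots> = colour_count l S c * (\<Prod>k<m. fact (colour_count l S k - (if c = k then 1 else 0)))"
    by (simp add: colour_count_def)
  also have "\<dots> = (\<Prod>k<m. fact (colour_count l S k))"
    using c pos by (simp add: prod.remove[of "{..<m}" c] fact_reduce)
  finally show ?case by (simp only: P_def)
qed

text \<open>Letters from \<open>m\<close> on have count zero on both sides. Hence a word determines
  its kind, and words of different kinds are disjoint.\<close>

lemma words_multi_index:
  assumes "k \<in> multi_indices m"
  shows "b \<in> words m k \<longleftrightarrow> set b \<subseteq> {..<m} \<and> count_list b = k"
proof -
  have "count_list b j = k j" if "b \<in> words m k" for j
    using that assms by (cases "j < m") (auto simp: words_def multi_indices_def count_list_0_iff)
  then show ?thesis by (auto simp: words_def fun_eq_iff)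
qed

text \<open>Here \<open>h\<close> is the logarithm, with coefficients given by single cycles. Strong
  induction on \<open>card S\<close> removes the cycle through a marked point; sorting these cycles
  by colour word gives the recursion of \<open>euler_deriv_mseries_exp\<close>.\<close>

lemma perm_sum_eq_mseries_exp:
  assumes h0: "h (\<lambda>_. 0) = 0"
    and h: "\<And>k. k \<in> multi_indices m \<Longrightarrow> k \<noteq> (\<lambda>_. 0) \<Longrightarrow>
      of_nat (index_degree m k) * h k = d * (\<Sum>b\<in>words m k. cyclic_weight t b)"
    and "finite S" "l ` S \<subseteq> {..<m}"
  shows "perm_sum d (\<lambda>x y. t (l x) (l y)) S =
    (\<Prod>j<m. fact (colour_count l S j)) * mseries_exp h (colour_count l S)"
  using assms(3,4)
proof (induction "card S" arbitrary: S rule: less_induct)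
  case less
  note S = less.prems
  show ?case
  proof (cases "S = {}")
    case True
    then have "colour_count l S = (\<lambda>_. 0)" by (simp add: colour_count_def fun_eq_iff)
    then show ?thesis
      using True mseries_exp_zero[of h] h0 by (simp add: perm_sum_def)
  next
    case False
    define c where "c = colour_count l S"
    define C where "C = (\<Prod>j<m. fact (c j) :: complex)"
    define L where "L = {xs. distinct xs \<and> xs \<noteq> [] \<and> set xs \<subseteq> S}"
    define K where "K = {k. k \<le> c \<and> k \<noteq> (\<lambda>_. 0)}"
    define Q where "Q = (\<lambda>b. d * cyclic_weight t b * mseries_exp h (\<lambda>j. c j - count_list b j))"
    have cm: "c \<in> multi_indices m" unfolding c_def by (rule colour_count_in_multi_indices[OF S(2)])
    have Km: "k \<in> multi_indices m" if "k \<in> K" for k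
      using that multi_indices_le[OF cm] by (simp add: K_def)
    have finK: "finite K"
      by (rule finite_subset[OF _ finite_indices_le[OF cm]]) (auto simp: K_def)
    have finL: "finite L"
      by (rule finite_subset[OF _ finite_distinct_lists_subset[OF S(1)]]) (auto simp: L_def)
    define B where "B = (\<Union>k\<in>K. words m k)"
    have finB: "finite B" using finK finite_words by (simp add: B_def)
    have BD: "set b \<subseteq> {..<m}" "count_list b \<in> K" if "b \<in> B" for b
      using that words_multi_index[OF Km] by (auto simp: B_def)
    have LB: "map l ` L \<subseteq> B"
    proof safe
      fix xs assume xs: "xs \<in> L"
      then have "count_list (map l xs) \<le> c"
        using colour_count_diff(2)[OF S(1)] by (auto simp: L_def le_fun_def c_def)
      moreover have "count_list (map l xs) \<noteq> (\<lambda>_. 0)"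
        using xs by (auto simp: L_def fun_eq_iff neq_Nil_conv intro!: exI[of _ "l (hd xs)"])
      ultimately have k: "count_list (map l xs) \<in> K" by (simp add: K_def)
      moreover have "l ` set xs \<subseteq> {..<m}"
        using xs S(2) by (auto simp: L_def)
      then have "map l xs \<in> words m (count_list (map l xs))"
        using words_multi_index[OF Km[OF k]] by simp
      ultimately show "map l xs \<in> B" by (auto simp: B_def)
    qed
    have "of_nat (card S) * perm_sum d (\<lambda>x y. t (l x) (l y)) S =
        (\<Sum>xs\<in>L. Q (map l xs) * (\<Prod>j<m. fact (c j - count_list (map l xs) j)))"
      unfolding card_mult_perm_sum[OF S(1)] L_def[symmetric]
    proof (intro sum.cong refl)
      fix xs assume xs: "xs \<in> L"
      then have "S - set xs \<subset> S" by (auto simp: L_def neq_Nil_conv)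
      then have "card (S - set xs) < card S" by (rule psubset_card_mono[OF S(1)])
      then have "perm_sum d (\<lambda>x y. t (l x) (l y)) (S - set xs) =
          (\<Prod>j<m. fact (colour_count l (S - set xs) j)) * mseries_exp h (colour_count l (S - set xs))"
        by (rule less.hyps) (use S in auto)
      moreover have "colour_count l (S - set xs) = (\<lambda>j. c j - count_list (map l xs) j)"
        using colour_count_diff(1)[OF S(1)] xs by (auto simp: c_def L_def fun_eq_iff)
      ultimately show "d * cyclic_weight (\<lambda>x y. t (l x) (l y)) xs * perm_sum d (\<lambda>x y. t (l x) (l y)) (S - set xs)
          = Q (map l xs) * (\<Prod>j<m. fact (c j - count_list (map l xs) j))"
        by (simp add: Q_def cyclic_weight_map)
    qed
    also have "\<dots> = (\<Sum>b\<in>B. \<Sum>xs | xs \<in> L \<and> map l xs = b. Q (map l xs) * (\<Prod>j<m. fact (c j - count_list (map l xs) j)))"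
      by (rule sum.group[OF finL finB LB, symmetric])
    \<comment> \<open>The number of lists with colour word \<open>b\<close>, times the leftover
      factorials, is \<open>C\<close> for every \<open>b\<close>.\<close>
    also have "\<dots> = (\<Sum>b\<in>B. Q b * C)"
    proof (intro sum.cong refl)
      fix b assume b: "b \<in> B"
      have ne: "b \<noteq> []" using BD(2)[OF b] by (auto simp: K_def)
      have "{xs. xs \<in> L \<and> map l xs = b} = {xs. distinct xs \<and> set xs \<subseteq> S \<and> map l xs = b}"
        using ne by (auto simp: L_def)
      moreover have "card {xs. distinct xs \<and> set xs \<subseteq> S \<and> map l xs = b} *
          (\<Prod>j<m. fact (c j - count_list b j)) = (\<Prod>j<m. fact (c j) :: nat)"
        unfolding c_def
        by (rule card_lists_with_colours[OF S(1)])
          (use BD[OF b] in \<open>auto simp: K_def le_fun_def c_def\<close>)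
      then have "of_nat (card {xs. distinct xs \<and> set xs \<subseteq> S \<and> map l xs = b} *
          (\<Prod>j<m. fact (c j - count_list b j))) = (of_nat (\<Prod>j<m. fact (c j)) :: complex)"
        by (simp only:)
      ultimately show "(\<Sum>xs | xs \<in> L \<and> map l xs = b. Q (map l xs) * (\<Prod>j<m. fact (c j - count_list (map l xs) j))) = Q b * C"
        by (simp add: C_def mult_ac)
    qed
    also have "\<dots> = (\<Sum>k\<in>K. \<Sum>b\<in>words m k. Q b * C)"
      unfolding B_def
      by (rule sum.UNION_disjoint) (use finK finite_words words_multi_index[OF Km] in auto)
    also have "\<dots> = (\<Sum>k\<in>K. C * (of_nat (index_degree m k) * h k * mseries_exp h (\<lambda>j. c j - k j)))"
    proof (intro sum.cong refl)
      fix k assume k: "k \<in> K"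
      have "(\<Sum>b\<in>words m k. Q b * C) =
          C * (d * (\<Sum>b\<in>words m k. cyclic_weight t b) * mseries_exp h (\<lambda>j. c j - k j))"
        using words_multi_index[OF Km[OF k]]
        by (auto simp: Q_def sum_distrib_left sum_distrib_right mult_ac intro!: sum.cong)
      then show "(\<Sum>b\<in>words m k. Q b * C) = C * (of_nat (index_degree m k) * h k * mseries_exp h (\<lambda>j. c j - k j))"
        using h[OF Km[OF k]] k by (simp add: K_def)
    qed
    \<comment> \<open>The restored term \<open>k = 0\<close> vanishes because its degree is
      0.\<close>
    also have "\<dots> = C * (\<Sum>k | k \<le> c. of_nat (index_degree m k) * h k * mseries_exp h (\<lambda>j. c j - k j))"
      unfolding sum_distrib_left K_def
      by (rule sum.mono_neutral_left[OF finite_indices_le[OF cm]]) auto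
    also have "\<dots> = C * (of_nat (index_degree m c) * mseries_exp h c)"
      by (simp only: euler_deriv_mseries_exp[where h = h, OF h0 cm])
    also have "index_degree m c = card S"
      unfolding c_def by (rule index_degree_colour_count[OF S])
    finally have "of_nat (card S) * perm_sum d (\<lambda>x y. t (l x) (l y)) S = of_nat (card S) * (C * mseries_exp h c)"
      by (simp only: mult_ac)
    then show ?thesis using False S(1) by (simp add: C_def c_def)
  qed
qed

section \<open>Single-row matrices\<close>

text \<open>All rows but the \<open>k\<close>-th are zero, so an eigenvector for a nonzero
  eigenvalue is supported at \<open>k\<close>, and the eigenvalue is
  \<open>c * T $$ (k, k)\<close>.\<close>

lemma spectral_radius_row_lt_1:
  assumes T: "T \<in> carrier_mat m m" and k: "k < m" and c: "norm (c * T $$ (k, k)) < 1"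
  shows "spectral_radius (mat_diag m (\<lambda>j. if j = k then c else 0) * T) < 1"
proof -
  define M where "M = mat_diag m (\<lambda>j. if j = k then c else 0) * T"
  have M: "M \<in> carrier_mat m m"
    unfolding M_def by (rule mult_carrier_mat[OF mat_diag_dim T])
  have M_index: "M $$ (r, s) = (if r = k then c * T $$ (k, s) else 0)" if "r < m" "s < m" for r s
    using that T by (auto simp: M_def mat_diag_mult_left)
  obtain \<mu> where \<mu>: "spectral_radius M = norm \<mu>" "\<mu> \<in> spectrum M"
    using spectral_radius_mem_max(1)[OF M] k by auto
  then obtain v where v: "v \<in> carrier_vec m" "v \<noteq> 0\<^sub>v m" "M *\<^sub>v v = \<mu> \<cdot>\<^sub>v v"
    using M by (auto simp: spectrum_def eigenvalue_def eigenvector_def)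
  have ev: "(\<Sum>s<m. M $$ (r, s) * v $ s) = \<mu> * v $ r" if "r < m" for r
  proof -
    have "(M *\<^sub>v v) $ r = (\<mu> \<cdot>\<^sub>v v) $ r" using v(3) by simp
    then show ?thesis
      using that M v(1) by (simp add: scalar_prod_def atLeast0LessThan)
  qed
  have "norm \<mu> < 1"
  proof (cases "\<mu> = 0")
    case False
    have zero: "v $ r = 0" if "r < m" "r \<noteq> k" for r
      using ev[OF that(1)] that False by (simp add: M_index)
    then have "v $ k \<noteq> 0" using v(1,2) by (metis carrier_vecD eq_vecI index_zero_vec)
    moreover have "(\<Sum>s<m. M $$ (k, s) * v $ s) = c * T $$ (k, k) * v $ k"
      using k zero by (simp add: M_index sum.remove[of "{..<m}" k])
    ultimately have "\<mu> = c * T $$ (k, k)" using ev[OF k] by simp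
    then show ?thesis using c by simp
  qed simp
  then show ?thesis using \<mu>(1) by (simp add: M_def)
qed

text \<open>Small multiples of the unit vectors \<open>z = e\<^sub>k\<close> satisfy the spectral condition, which
  determines all the \<open>\<Sigma> H\<^sub>k\<close>.\<close>

lemma row_decomposition:
  assumes m: "m > 0" and T: "T \<in> carrier_mat m m" and \<Sigma>: "\<Sigma> \<in> carrier_mat p p"
    and H: "\<And>k. k < m \<Longrightarrow> H k \<in> carrier_mat p p"
    and eq: "\<And>z. spectral_radius (mat_diag m z * T) < 1 \<Longrightarrow>
      mat_diag m z * T = \<Sigma> * mat_lincomb p m H z"
  shows "p = m"
    and "\<And>k r s. k < m \<Longrightarrow> r < m \<Longrightarrow> s < m \<Longrightarrow>
      (\<Sigma> * H k) $$ (r, s) = (if r = k then T $$ (k, s) else 0)"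
proof -
  \<comment> \<open>This is \<open>z = 0\<close>, written in the shape of the spectral lemma;
    comparing the numbers of rows gives \<open>p = m\<close>.\<close>
  have "mat_diag m (\<lambda>j. if j = 0 then 0 else 0) * T =
      \<Sigma> * mat_lincomb p m H (\<lambda>j. if j = 0 then 0 else 0)"
    by (rule eq, rule spectral_radius_row_lt_1[OF T m]) simp
  from arg_cong[OF this, of dim_row] show pm: "p = m"
    using T \<Sigma> by (simp add: mat_diag_def)
  fix k r s assume k: "k < m" and r: "r < m" and s: "s < m"
  \<comment> \<open>Small enough for \<open>z = c e_k\<close> to meet the spectral condition, yet
    nonzero, so that \<open>c\<close> cancels at the end.\<close>
  define c :: complex where "c = of_real (1 / (1 + norm (T $$ (k, k))))"
  have den: "1 + norm (T $$ (k, k)) > 0" by (simp add: add_pos_nonneg)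
  have norm_c: "norm c = 1 / (1 + norm (T $$ (k, k)))"
    unfolding c_def norm_of_real using den by simp
  with den have c0: "c \<noteq> 0" by force
  from norm_c have "norm (c * T $$ (k, k)) < 1" using den by (simp add: norm_mult)
  then have "mat_diag m (\<lambda>j. if j = k then c else 0) * T =
      \<Sigma> * mat_lincomb p m H (\<lambda>j. if j = k then c else 0)"
    by (intro eq spectral_radius_row_lt_1[OF T k])
  moreover have "mat_lincomb p m H (\<lambda>j. if j = k then c else 0) = c \<cdot>\<^sub>m H k"
    using k H[OF k] by (intro eq_matI) (auto simp: mat_lincomb_def sum.remove[of "{..<m}" k])
  moreover have "\<Sigma> * (c \<cdot>\<^sub>m H k) = c \<cdot>\<^sub>m (\<Sigma> * H k)"
    by (rule mult_smult_distrib[OF \<Sigma> H[OF k]])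
  ultimately have "mat_diag m (\<lambda>j. if j = k then c else 0) * T = c \<cdot>\<^sub>m (\<Sigma> * H k)" by simp
  then have "(mat_diag m (\<lambda>j. if j = k then c else 0) * T) $$ (r, s) = (c \<cdot>\<^sub>m (\<Sigma> * H k)) $$ (r, s)"
    by simp
  then have "(if r = k then c * T $$ (k, s) else 0) = c * (\<Sigma> * H k) $$ (r, s)"
    using r s T \<Sigma> H[OF k] pm by (simp add: mat_diag_mult_left split: if_splits)
  then show "(\<Sigma> * H k) $$ (r, s) = (if r = k then T $$ (k, s) else 0)"
    using c0 by (auto split: if_splits)
qed

text \<open>Each factor lives on the row of its letter, so every intermediate index is forced to be
  the next letter and a single closed walk survives.\<close>

lemma mat_trace_string_mat_prod:
  assumes A: "\<And>k. k < m \<Longrightarrow> A k \<in> carrier_mat m m"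
    and row: "\<And>k r s. k < m \<Longrightarrow> r < m \<Longrightarrow> s < m \<Longrightarrow> A k $$ (r, s) = (if r = k then t k s else 0)"
    and a: "a \<noteq> []" "set a \<subseteq> {..<m}"
  shows "mat_trace (string_mat_prod m A a) = cyclic_weight t a"
proof -
  have carrier: "string_mat_prod m A b \<in> carrier_mat m m" if "set b \<subseteq> {..<m}" for b
    using that by (induction b) (auto simp: string_mat_prod_def intro!: mult_carrier_mat A)
  \<comment> \<open>Appending the column \<open>s\<close> gives the last letter a successor; in the
    trace \<open>s\<close> is \<open>hd a\<close>, which closes the walk.\<close>
  have entry: "string_mat_prod m A b $$ (r, s) =
      (if r = hd b then \<Prod>q<length b. t (b ! q) ((b @ [s]) ! Suc q) else 0)"
    if "b \<noteq> []" "set b \<subseteq> {..<m}" "r < m" "s < m" for b r s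
    using that
  proof (induction b arbitrary: r)
    case (Cons k b)
    have k: "k < m" using Cons.prems by simp
    have rec: "string_mat_prod m A (k # b) = A k * string_mat_prod m A b"
      by (simp add: string_mat_prod_def)
    show ?case
    proof (cases "b = []")
      case True
      then have "string_mat_prod m A (k # b) = A k"
        using A[OF k] by (simp add: string_mat_prod_def)
      then show ?thesis using True Cons.prems k by (simp add: row)
    next
      case False
      define c where "c = hd b"
      have c: "c < m" using Cons.prems(2) hd_in_set[OF False] unfolding c_def by auto
      have "string_mat_prod m A (k # b) $$ (r, s) =
          (\<Sum>q<m. A k $$ (r, q) * string_mat_prod m A b $$ (q, s))"
        unfolding rec using A[OF k] carrier[of b] Cons.prems
        by (simp add: scalar_prod_def atLeast0LessThan)
      \<comment> \<open>The tail product vanishes outside row \<open>hd b\<close>.\<close>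
      also have "\<dots> = (\<Sum>q<m. if q = c then A k $$ (r, c) * string_mat_prod m A b $$ (c, s) else 0)"
        using Cons.IH[OF False] Cons.prems by (intro sum.cong) (auto simp: c_def)
      also have "\<dots> = A k $$ (r, c) * string_mat_prod m A b $$ (c, s)"
        using c by simp
      also have "\<dots> = (if r = k then t k c * (\<Prod>q<length b. t (b ! q) ((b @ [s]) ! Suc q)) else 0)"
        using Cons.IH[OF False, of c] Cons.prems c k by (simp add: row c_def)
      also have "t k c = t k ((b @ [s]) ! 0)"
        using False by (simp add: c_def hd_conv_nth nth_append)
      finally show ?thesis by (simp add: prod.lessThan_Suc_shift del: prod.lessThan_Suc)
    qed
  qed simp
  have hd: "hd a < m" using hd_in_set[OF a(1)] a(2) by auto
  have "mat_trace (string_mat_prod m A a) = (\<Sum>r<m. string_mat_prod m A a $$ (r, r))"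
    using carrier[OF a(2)] by (simp add: mat_trace_def)
  also have "\<dots> = (\<Sum>r<m. if r = hd a then \<Prod>q<length a. t (a ! q) ((a @ [hd a]) ! Suc q) else 0)"
    by (intro sum.cong refl) (simp add: entry[OF a])
  also have "\<dots> = (\<Prod>q<length a. t (a ! q) ((a @ [hd a]) ! Suc q))"
    using hd by simp
  also have "\<dots> = cyclic_weight t a"
    unfolding cyclic_weight_def
  proof (intro prod.cong refl)
    fix q assume "q \<in> {..<length a}"
    then have "(a @ [hd a]) ! Suc q = a ! (Suc q mod length a)"
      using a(1) by (cases "Suc q = length a") (auto simp: nth_append hd_conv_nth)
    then show "t (a ! q) ((a @ [hd a]) ! Suc q) = t (a ! q) (a ! (Suc q mod length a))" by simp
  qed
  finally show ?thesis .
qed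

section \<open>The \<open>d\<close>-permanent of a repeated matrix\<close>

lemma set_index_word: "set (index_word m i) \<subseteq> {..<m}"
  by (auto simp: index_word_def)

lemma count_list_index_word: "count_list (index_word m i) k = (if k < m then i k else 0)"
proof -
  have *: "count_list (replicate n x) y = (if x = y then n else 0)" for n x y :: nat
    by (induction n) auto
  show ?thesis
    by (induction m) (auto simp: index_word_def *)
qed

lemma d_permanent_repeated_mat:
  fixes m :: nat and i :: "nat \<Rightarrow> nat"
  defines "w \<equiv> index_word m i"
  shows "d_permanent d (repeated_mat m T i) =
    perm_sum d (\<lambda>x y. T $$ (w ! x, w ! y)) {..<length w}"
proof -
  have "repeated_mat m T i $$ (j, \<sigma> j) = T $$ (w ! j, w ! \<sigma> j)"
    if "\<sigma> permutes {..<length w}" "j < length w" for \<sigma> j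
    using that permutes_in_image[OF that(1), of j] by (simp add: repeated_mat_def w_def Let_def)
  moreover have "dim_row (repeated_mat m T i) = length w"
    by (simp add: repeated_mat_def w_def Let_def)
  ultimately show ?thesis
    unfolding d_permanent_def perm_sum_def cycle_count_def
    by (auto intro!: sum.cong prod.cong)
qed

lemma colour_count_nth: "colour_count ((!) w) {..<length w} = count_list w"
proof
  fix k
  have "colour_count ((!) w) (set [0..<length w]) k = count_list (map ((!) w) [0..<length w]) k"
    by (rule colour_count_set) simp
  then show "colour_count ((!) w) {..<length w} k = count_list w k"
    by (simp add: map_nth atLeast0LessThan)
qed

text \<open>The factorial moments of the \<open>u j\<close> cancel the factorials of the exponential
  generating function, leaving the ordinary generating function of the moments of \<rho>.\<close>

lemma umbral_gf_factorial_mult: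
  assumes "uncorrelated_factorial_umbrae E m u \<rho>" "k \<in> multi_indices m"
  shows "umbral_gf E m (\<lambda>j. umbra (u j) * \<rho> j) k = E (tuple_power m \<rho> k)"
proof -
  have "tuple_power m (\<lambda>j. umbra (u j) * \<rho> j) k =
      tuple_power m (\<lambda>j. umbra (u j)) k * tuple_power m \<rho> k"
    by (simp add: tuple_power_def power_mult_distrib prod.distrib)
  then have "E (tuple_power m (\<lambda>j. umbra (u j) * \<rho> j) k) =
      (\<Prod>j<m. fact (k j)) * E (tuple_power m \<rho> k)"
    using assms by (simp add: uncorrelated_factorial_umbrae_def)
  then show ?thesis by (simp add: umbral_gf_def)
qed

text \<open>Check of the divisor: for \<open>m = 1\<close> and kind 2, the string \<open>00\<close>
  has one rotation and \<open>necklace_order\<close> 2, and the coefficient 1/2 reproduces the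
  permanent \<open>(d^2 + d) t^2\<close>.\<close>

theorem proposition20:
  fixes d :: complex
    and m p :: nat
    and T \<Sigma> :: "complex mat"
    and H :: "nat \<Rightarrow> complex mat"
    and E :: "'u umbral_poly \<Rightarrow> complex"
    and u :: "nat \<Rightarrow> 'u"
    and \<rho> \<kappa> :: "nat \<Rightarrow> 'u umbral_poly"
    and i :: "nat \<Rightarrow> nat"
  assumes "m > 0"
    and "T \<in> carrier_mat m m"
    and "\<Sigma> \<in> carrier_mat p p" and "transpose_mat \<Sigma> = \<Sigma>"
    and "\<And>k. k < m \<Longrightarrow> H k \<in> carrier_mat p p"
    and "\<And>z. spectral_radius (mat_diag m z * T) < 1 \<Longrightarrow>
           mat_diag m z * T = \<Sigma> * mat_lincomb p m H z"
    and "evaluation_functional E"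
    and "\<And>j. j < m \<Longrightarrow> umbral_monomial (\<rho> j)"
    and "\<And>j. j < m \<Longrightarrow> umbral_monomial (\<kappa> j)"
    and "uncorrelated_factorial_umbrae E m u \<rho>"
    and "\<And>k. k \<in> multi_indices m \<Longrightarrow> k \<noteq> (\<lambda>_. 0) \<Longrightarrow>
           E (tuple_power m \<rho> k) =
             (\<Sum>a\<in>aperiodic_necklaces m k. mat_trace (string_mat_prod p (\<lambda>l. \<Sigma> * H l) a)) +
             (\<Sum>a\<in>necklaces m k - aperiodic_necklaces m k.
                1 / of_nat (necklace_order a) *
                mat_trace (string_mat_prod p (\<lambda>l. \<Sigma> * H l) a))"
    and "represents_dot_bell E m d (\<lambda>j. umbra (u j) * \<rho> j) \<kappa>"
    and "i \<in> multi_indices m"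
  shows "d_permanent d (repeated_mat m T i) = E (tuple_power m \<kappa> i)"
proof -
  define t where "t = (\<lambda>x y. T $$ (x, y))"
  define h where "h = (\<lambda>j. d * (umbral_gf E m (\<lambda>j. umbra (u j) * \<rho> j) j - mseries_one j))"
  have pm: "p = m"
    by (rule row_decomposition(1)[of m T \<Sigma> p H]) (use assms in auto)
  have row: "(\<Sigma> * H k) $$ (r, s) = (if r = k then t k s else 0)" if "k < m" "r < m" "s < m" for k r s
    unfolding t_def by (rule row_decomposition(2)[of m T \<Sigma> p H]) (use assms that in auto)
  have carrier: "\<Sigma> * H k \<in> carrier_mat m m" if "k < m" for k
    using assms(3) assms(5)[OF that] unfolding pm by (rule mult_carrier_mat)
  have trace: "mat_trace (string_mat_prod p (\<lambda>l. \<Sigma> * H l) a) = cyclic_weight t a"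
    if "a \<noteq> []" "set a \<subseteq> {..<m}" for a
    using mat_trace_string_mat_prod[where A = "\<lambda>l. \<Sigma> * H l" and t = t, OF carrier row that]
    unfolding pm .
  have E1: "E 1 = 1" using assms(7) by (simp add: evaluation_functional_def)
  have h0: "h (\<lambda>_. 0) = 0"
    by (simp add: h_def umbral_gf_def tuple_power_def E1 mseries_one_def)
  have h: "of_nat (index_degree m k) * h k = d * (\<Sum>b\<in>words m k. cyclic_weight t b)"
    if k: "k \<in> multi_indices m" "k \<noteq> (\<lambda>_. 0)" for k
  proof -
    \<comment> \<open>Excludes the empty string, whose trace is \<open>p\<close> but whose cyclic
      weight is 1.\<close>
    have deg: "(\<Sum>j<m. k j) \<noteq> 0"
      using index_degree_eq_0_iff[OF k(1)] k(2) unfolding index_degree_def by blast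
    have neck: "a \<noteq> []" "set a \<subseteq> {..<m}" if "a \<in> necklaces m k" for a
    proof -
      have a: "a \<in> words m k" using that by (auto simp: necklaces_def words_def)
      then show "set a \<subseteq> {..<m}" by (simp add: words_def)
      show "a \<noteq> []" using length_words[OF a] deg by auto
    qed
    have "h k = d * E (tuple_power m \<rho> k)"
      using k umbral_gf_factorial_mult[OF assms(10) k(1)] by (simp add: h_def mseries_one_def)
    also have "E (tuple_power m \<rho> k) = (\<Sum>a\<in>aperiodic_necklaces m k. cyclic_weight t a) +
        (\<Sum>a\<in>necklaces m k - aperiodic_necklaces m k.
          1 / of_nat (necklace_order a) * cyclic_weight t a)"
      unfolding assms(11)[OF k]
      by (intro arg_cong2[where f = "(+)"] sum.cong refl)
        (use trace neck in \<open>auto simp: aperiodic_necklaces_def\<close>)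
    finally show ?thesis
      using sum_necklaces_eq_sum_words[of "cyclic_weight t", OF cyclic_weight_rotate deg]
      by (simp add: index_degree_def mult.left_commute)
  qed
  define w where "w = index_word m i"
  have count: "colour_count ((!) w) {..<length w} = i"
    unfolding colour_count_nth w_def
    using assms(13) by (auto simp: fun_eq_iff count_list_index_word multi_indices_def)
  have "(!) w ` {..<length w} \<subseteq> {..<m}"
    using set_index_word[of m i] nth_mem unfolding w_def by blast
  then have "d_permanent d (repeated_mat m T i) = (\<Prod>j<m. fact (i j)) * mseries_exp h i"
    using perm_sum_eq_mseries_exp[of h m d t "{..<length w}" "(!) w", OF h0 h]
    unfolding d_permanent_repeated_mat w_def[symmetric] count by (simp add: t_def)
  also have "mseries_exp h i = umbral_gf E m \<kappa> i"
    using assms(12,13) by (simp add: represents_dot_bell_def h_def)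
  also have "(\<Prod>j<m. fact (i j)) * umbral_gf E m \<kappa> i = E (tuple_power m \<kappa> i)"
    by (simp add: umbral_gf_def)
  finally show ?thesis .
qed

end
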